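(* Define maps $\Psi_1:(\mathcal M_{mn},\star)\to(\mathcal C_m(r),\cdot)$, $X\mapsto XJ$; $\Psi_2:(\mathcal M_{mn},\star)\to(\mathcal R_n(r),\cdot)$, $X\mapsto JX$; $\Phi_1:(\mathcal C_m(r),\cdot)\to(\mathcal M_r,\cdot)$, $\begin{bmatrix}A&O\\C&O\end{bmatrix}\mapsto A$; $\Phi_2:(\mathcal R_n(r),\cdot)\to(\mathcal M_r,\cdot)$, $\begin{bmatrix}A&B\\O&O\end{bmatrix}\mapsto A$, where in each case $A\in\mathcal M_r$. Then $\Psi_1,\Psi_2,\Phi_1,\Phi_2$ are (well-defined) surjective semigroup homomorphisms, and $\Phi_1\circ\Psi_1=\Phi_2\circ\Psi_2$. Moreover, these maps restrict to surjective semigroup homomorphisms $\psi_1:\operatorname{Reg}(\mathcal M_{mn}^J)\to\operatorname{Reg}(\mathcal C_m(r))$, $\psi_2:\operatorname{Reg}(\mathcal M_{mn}^J)\to\operatorname{Reg}(\mathcal R_n(r))$, $\phi_1:\operatorname{Reg}(\mathcal C_m(r))\to\mathcal M_r$, $\phi_2:\operatorname{Reg}(\mathcal R_n(r))\to\mathcal M_r$, with $\phi_1\circ\psi_1=\phi_2\circ\psi_2$.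
   Context: Let $\mathbb F$ be a field, $m,n\geq1$ integers, and $0\leq r\leq\min(m,n)$. $\mathcal M_{kl}$ denotes the set of all $k\times l$ matrices over $\mathbb F$ (a single empty matrix if $k=0$ or $l=0$), and $\mathcal M_k=\mathcal M_{kk}$. Let $J=\begin{bmatrix}I_r&O\\O&O\end{bmatrix}\in\mathcal M_{nm}$ (an $n\times m$ matrix), and let $\mathcal M_{mn}^J=(\mathcal M_{mn},\star)$ be the semigroup with underlying set $\mathcal M_{mn}$ and operation $X\star Y=XJY$. For $0\leq l\leq k$, $k\geq1$: $\mathcal C_k(l)$ is the set of all $X\in\mathcal M_k$ whose columns $l+1,\ldots,k$ are zero, and $\mathcal R_k(l)$ is the set of all $X\in\mathcal M_k$ whose rows $l+1,\ldots,k$ are zero; both are semigroups under ordinary matrix multiplication $\cdot$. $\operatorname{Reg}(T)$ denotes the set of regular elements of a semigroup $T$ (those $x$ with $x=xyx$ for some $y\in T$). In the present cases these sets are subsemigroups. *)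

theory Defs
  imports "Jordan_Normal_Form.Matrix" "HOL-Library.FuncSet"
begin

definition semigroup_on :: "'a set \<Rightarrow> ('a \<Rightarrow> 'a \<Rightarrow> 'a) \<Rightarrow> bool" where
  "semigroup_on S f \<longleftrightarrow>
     (\<forall>x\<in>S. \<forall>y\<in>S. f x y \<in> S) \<and>
     (\<forall>x\<in>S. \<forall>y\<in>S. \<forall>z\<in>S. f (f x y) z = f x (f y z))"

definition surj_semigroup_hom ::
  "'a set \<Rightarrow> ('a \<Rightarrow> 'a \<Rightarrow> 'a) \<Rightarrow> 'b set \<Rightarrow> ('b \<Rightarrow> 'b \<Rightarrow> 'b) \<Rightarrow> ('a \<Rightarrow> 'b) \<Rightarrow> bool" where
  "surj_semigroup_hom S f T g h \<longleftrightarrow>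
     semigroup_on S f \<and> semigroup_on T g \<and>
     h \<in> S \<rightarrow> T \<and>
     (\<forall>x\<in>S. \<forall>y\<in>S. h (f x y) = g (h x) (h y)) \<and>
     h ` S = T"

definition Reg :: "'a set \<Rightarrow> ('a \<Rightarrow> 'a \<Rightarrow> 'a) \<Rightarrow> 'a set" where
  "Reg S f = {x \<in> S. \<exists>y\<in>S. x = f (f x y) x}"

definition J_mat :: "nat \<Rightarrow> nat \<Rightarrow> nat \<Rightarrow> 'a::field mat" where
  "J_mat m n r = four_block_mat (1\<^sub>m r) (0\<^sub>m r (m - r))
                               (0\<^sub>m (n - r) r) (0\<^sub>m (n - r) (m - r))"

text \<open>The matrix \<open>J_mat m n r\<close> has size \<open>n \<times> m\<close>, so the sandwich product below is an
  operation on \<open>carrier_mat m n\<close>.\<close>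

definition star_mat :: "nat \<Rightarrow> nat \<Rightarrow> nat \<Rightarrow> 'a::field mat \<Rightarrow> 'a mat \<Rightarrow> 'a mat" where
  "star_mat m n r X Y = X * J_mat m n r * Y"

text \<open>Rows and columns are indexed from 0, so columns (rows) \<open>l+1, \<dots>, k\<close> are the indices
  \<open>j\<close> with \<open>l \<le> j < k\<close>.\<close>

definition C_mat :: "nat \<Rightarrow> nat \<Rightarrow> 'a::field mat set" where
  "C_mat k l = {X \<in> carrier_mat k k. \<forall>i<k. \<forall>j<k. l \<le> j \<longrightarrow> X $$ (i, j) = 0}"

definition R_mat :: "nat \<Rightarrow> nat \<Rightarrow> 'a::field mat set" where
  "R_mat k l = {X \<in> carrier_mat k k. \<forall>i<k. \<forall>j<k. l \<le> i \<longrightarrow> X $$ (i, j) = 0}"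

definition Psi1 :: "nat \<Rightarrow> nat \<Rightarrow> nat \<Rightarrow> 'a::field mat \<Rightarrow> 'a mat" where
  "Psi1 m n r X = X * J_mat m n r"

definition Psi2 :: "nat \<Rightarrow> nat \<Rightarrow> nat \<Rightarrow> 'a::field mat \<Rightarrow> 'a mat" where
  "Psi2 m n r X = J_mat m n r * X"

text \<open>The maps \<open>\<Phi>\<^sub>1\<close> and \<open>\<Phi>\<^sub>2\<close> both return the upper left \<open>r \<times> r\<close> block; they differ only
  in their domains, \<open>C_mat m r\<close> and \<open>R_mat n r\<close>. The lemmas below confirm the block
  descriptions.\<close>

definition Phi1 :: "nat \<Rightarrow> 'a::field mat \<Rightarrow> 'a mat" where
  "Phi1 r X = (case split_block X r r of (A, B, C, D) \<Rightarrow> A)"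

definition Phi2 :: "nat \<Rightarrow> 'a::field mat \<Rightarrow> 'a mat" where
  "Phi2 r X = (case split_block X r r of (A, B, C, D) \<Rightarrow> A)"

lemma Phi1_four_block_mat:
  assumes "A \<in> carrier_mat r r" "C \<in> carrier_mat (m - r) r"
  shows "Phi1 r (four_block_mat A (0\<^sub>m r (m - r)) C (0\<^sub>m (m - r) (m - r))) = A"
  using assms by (auto simp: Phi1_def split_block_def Let_def)

lemma Phi2_four_block_mat:
  assumes "A \<in> carrier_mat r r" "B \<in> carrier_mat r (n - r)"
  shows "Phi2 r (four_block_mat A B (0\<^sub>m (n - r) r) (0\<^sub>m (n - r) (n - r))) = A"
  using assms by (auto simp: Phi2_def split_block_def Let_def)

lemma C_mat_eq_four_block_mat:
  assumes "r \<le> m"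
  shows "C_mat m r = {four_block_mat A (0\<^sub>m r (m - r)) C (0\<^sub>m (m - r) (m - r)) | A C.
           A \<in> carrier_mat r r \<and> C \<in> carrier_mat (m - r) r}" (is "_ = ?B")
proof
  show "?B \<subseteq> C_mat m r"
    using assms by (auto simp: C_mat_def)
  show "C_mat m r \<subseteq> ?B"
  proof
    fix X :: "'a mat" assume X: "X \<in> C_mat m r"
    let ?A = "mat r r (\<lambda>(i, j). X $$ (i, j))"
    let ?C = "mat (m - r) r (\<lambda>(i, j). X $$ (i + r, j))"
    have "X = four_block_mat ?A (0\<^sub>m r (m - r)) ?C (0\<^sub>m (m - r) (m - r))"
      using X assms by (intro eq_matI) (auto simp: C_mat_def)
    moreover have "?A \<in> carrier_mat r r" "?C \<in> carrier_mat (m - r) r"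
      by simp_all
    ultimately show "X \<in> ?B"
      by blast
  qed
qed

lemma R_mat_eq_four_block_mat:
  assumes "r \<le> n"
  shows "R_mat n r = {four_block_mat A B (0\<^sub>m (n - r) r) (0\<^sub>m (n - r) (n - r)) | A B.
           A \<in> carrier_mat r r \<and> B \<in> carrier_mat r (n - r)}" (is "_ = ?B")
proof
  show "?B \<subseteq> R_mat n r"
    using assms by (auto simp: R_mat_def)
  show "R_mat n r \<subseteq> ?B"
  proof
    fix X :: "'a mat" assume X: "X \<in> R_mat n r"
    let ?A = "mat r r (\<lambda>(i, j). X $$ (i, j))"
    let ?C = "mat r (n - r) (\<lambda>(i, j). X $$ (i, j + r))"
    have "X = four_block_mat ?A ?C (0\<^sub>m (n - r) r) (0\<^sub>m (n - r) (n - r))"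
      using X assms by (intro eq_matI) (auto simp: R_mat_def)
    moreover have "?A \<in> carrier_mat r r" "?C \<in> carrier_mat r (n - r)"
      by simp_all
    ultimately show "X \<in> ?B"
      by blast
  qed
qed

end

theory Submission
  imports Defs "Jordan_Normal_Form.Gauss_Jordan_Elimination"
begin

text \<open>In each of the four maps the sandwich product \<open>x u y\<close> in the source depends on the middle
  factor \<open>u\<close> only through its image. For such a surjective homomorphism a regular element of the
  target lifts to a regular one, and the regular elements of the source are closed under
  multiplication as soon as those of the target are. The starting point is that every matrix over a
  field is regular, which is read off from the reduced row echelon form.\<close>

section \<open>Regular elements along a surjective homomorphism\<close>

lemma semigroup_onD:
  assumes "semigroup_on S f"
  shows "x \<in> S \<Longrightarrow> y \<in> S \<Longrightarrow> f x y \<in> S"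
    and "x \<in> S \<Longrightarrow> y \<in> S \<Longrightarrow> z \<in> S \<Longrightarrow> f (f x y) z = f x (f y z)"
  using assms by (auto simp: semigroup_on_def)

text \<open>Replacing a witness \<open>y\<close> by \<open>y x y\<close> gives a mutual inverse. All
  products are nested to the right, the normal form reached when associativity is used as a rewrite
  rule.\<close>

lemma Reg_inverseE:
  assumes "semigroup_on S f" "x \<in> Reg S f"
  obtains y where "x \<in> S" "y \<in> S" "f x (f y x) = x" "f y (f x y) = y"
proof -
  note S = semigroup_onD[OF assms(1)]
  obtain y where y: "x \<in> S" "y \<in> S" "f x (f y x) = x"
    using assms(2) S by (auto simp: Reg_def)
  \<comment> \<open>The trailing factor \<open>w\<close> lets \<open>x y x = x\<close> rewrite
    inside longer right-nested products.\<close>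
  have xyx: "f x (f y (f x w)) = f x w" if "w \<in> S" for w
    using y S that by (metis (no_types))
  show ?thesis
    by (rule that[of "f y (f x y)"]) (use y xyx S in simp_all)
qed

text \<open>Products of regular elements need not be regular in a general semigroup, so closure is
  assumed in the target and pulled back. An equation between images under \<open>h\<close> becomes
  an equation in \<open>S\<close> once both sides are flanked by elements of \<open>S\<close>;
  inverses provide flanks that leave the products in question unchanged.\<close>

lemma surj_semigroup_hom_Reg:
  assumes hom: "surj_semigroup_hom S f T g h"
    and sandwich: "\<And>x y u v. x \<in> S \<Longrightarrow> y \<in> S \<Longrightarrow> u \<in> S \<Longrightarrow> v \<in> S \<Longrightarrow> h u = h v \<Longrightarrow>
      f x (f u y) = f x (f v y)"
    and RegT: "semigroup_on (Reg T g) g"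
  shows "surj_semigroup_hom (Reg S f) f (Reg T g) g h"
proof -
  have sgS: "semigroup_on S f" and sgT: "semigroup_on T g"
    and hT: "\<And>x. x \<in> S \<Longrightarrow> h x \<in> T"
    and hm: "\<And>x y. x \<in> S \<Longrightarrow> y \<in> S \<Longrightarrow> h (f x y) = g (h x) (h y)"
    and onto: "h ` S = T"
    using hom by (auto simp: surj_semigroup_hom_def)
  note S = semigroup_onD[OF sgS] and T = semigroup_onD[OF sgT]
  have RegI: "x \<in> Reg S f" if "x \<in> S" "y \<in> S" "f x (f y x) = x" for x y
    using that S by (auto simp: Reg_def intro!: bexI[of _ y])
  have RegS: "x \<in> S" if "x \<in> Reg S f" for x
    using that by (simp add: Reg_def)
  have maps: "h x \<in> Reg T g" if "x \<in> Reg S f" for x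
  proof -
    obtain y where "x \<in> S" "y \<in> S" "f x (f y x) = x"
      by (rule Reg_inverseE[OF sgS \<open>x \<in> Reg S f\<close>])
    then have "h x = g (g (h x) (h y)) (h x)"
      using hm hT S T by metis
    then show ?thesis
      using \<open>x \<in> S\<close> \<open>y \<in> S\<close> hT by (auto simp: Reg_def)
  qed
  have closed: "f x y \<in> Reg S f" if x: "x \<in> Reg S f" and y: "y \<in> Reg S f" for x y
  proof -
    obtain e where e: "x \<in> S" "e \<in> S" "f x (f e x) = x"
      using Reg_inverseE[OF sgS x] by blast
    obtain d where d: "y \<in> S" "d \<in> S" "f y (f d y) = y"
      using Reg_inverseE[OF sgS y] by blast
    have xy: "f x y \<in> S"
      using e d S by simp
    have "h (f x y) \<in> Reg T g"
      using semigroup_onD(1)[OF RegT maps[OF x] maps[OF y]] hm e d by simp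
    \<comment> \<open>An inverse of \<open>h (f x y)\<close> is lifted to \<open>c\<close>. At first
      \<open>c\<close> satisfies the regularity equation for \<open>x y\<close> only after applying
      \<open>h\<close>; the rest of the argument removes \<open>h\<close>.\<close>
    then obtain c' where c': "c' \<in> T" "g (h (f x y)) (g c' (h (f x y))) = h (f x y)"
      by (rule Reg_inverseE[OF sgT])
    then obtain c where "c \<in> S" "h c = c'"
      using onto by blast
    with c' have c: "c \<in> S" "h (f (f x y) (f c (f x y))) = h (f x y)"
      using hm[OF xy S(1)[OF _ xy]] hm[OF _ xy] by auto
    let ?u = "f (f x y) (f c (f x y))"
    have u: "?u \<in> S"
      using xy c S by simp
    \<comment> \<open>The middle factors \<open>e u d\<close> and \<open>e (x y) d\<close> have
      equal images, so they are interchangeable between \<open>x\<close> and \<open>y\<close>. Since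
      \<open>x e\<close> fixes \<open>x y\<close> from the left and \<open>d y\<close> fixes it from
      the right, this yields \<open>u = x y\<close>.\<close>
    have hh: "h (f e (f ?u d)) = h (f e (f (f x y) d))"
      using hm[OF e(2) S(1)[OF u d(2)]] hm[OF u d(2)] c(2)
        hm[OF e(2) S(1)[OF xy d(2)]] hm[OF xy d(2)] by simp
    have x1: "f (f x e) (f x y) = f x y"
      using S(2)[OF S(1)[OF e(1,2)] e(1) d(1)] S(2)[OF e(1,2,1)] e(3) by simp
    have y1: "f (f x y) (f d y) = f x y"
      using S(2)[OF e(1) d(1) S(1)[OF d(2,1)]] d(3) by simp
    have absorb: "f x (f (f e (f w d)) y) = f (f x e) (f w (f d y))" if "w \<in> S" for w
      using that e d S by simp
    have "f (f x e) (f ?u (f d y)) = f (f x e) (f (f x y) (f d y))"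
      using sandwich[OF e(1) d(1) _ _ hh] absorb[OF u] absorb[OF xy]
        S(1)[OF e(2) S(1)[OF u d(2)]] S(1)[OF e(2) S(1)[OF xy d(2)]] by (simp only:)
    \<comment> \<open>The element \<open>u\<close> begins and ends with \<open>x y\<close>, so it
      absorbs \<open>x e\<close> and \<open>d y\<close> too.\<close>
    moreover have "f (f x e) (f ?u (f d y)) = ?u"
    proof -
      have "f (f x e) (f ?u (f d y)) = f (f (f x e) (f x y)) (f c (f (f x y) (f d y)))"
      proof -
        have xe: "f x e \<in> S" and dy: "f d y \<in> S" and cxy: "f c (f x y) \<in> S"
          using e d c xy S by auto
        have "f ?u (f d y) = f (f x y) (f c (f (f x y) (f d y)))"
          using S(2)[OF xy cxy dy] S(2)[OF c(1) xy dy] by simp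
        then show ?thesis
          using S(2)[OF xe xy S(1)[OF c(1) S(1)[OF xy dy]]] by simp
      qed
      then show ?thesis
        using x1 y1 by simp
    qed
    moreover have "f (f x e) (f (f x y) (f d y)) = f x y"
      using x1 y1 by simp
    ultimately have "?u = f x y"
      by simp
    then show ?thesis
      using RegI[OF xy c(1)] by simp
  qed
  have lifts: "\<exists>x \<in> Reg S f. h x = t" if t: "t \<in> Reg T g" for t
  proof -
    obtain s where s: "t \<in> T" "s \<in> T" "g t (g s t) = t" "g s (g t s) = s"
      using Reg_inverseE[OF sgT t] by blast
    obtain a b where ab: "a \<in> S" "b \<in> S" "h a = t" "h b = s"
      using s onto by blast
    \<comment> \<open>The lift \<open>a\<close> itself need not be regular; \<open>a b a\<close> is, with inverse \<open>b\<close>.\<close>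
    let ?x = "f a (f b a)"
    \<comment> \<open>From \<open>s t s = s\<close>, the elements \<open>b a b a b\<close> and
      \<open>b\<close> have the same image; placing them between two copies of \<open>a\<close>
      gives \<open>(a b a) b (a b a) = a b a\<close>.\<close>
    have "h (f b (f a (f b (f a b)))) = h b"
      using ab s S T hm by simp
    then have "f a (f (f b (f a (f b (f a b)))) a) = f a (f b a)"
      by (intro sandwich[OF ab(1) ab(1) _ ab(2)]) (use ab S in simp_all)
    then have "f ?x (f b ?x) = ?x"
      using ab S by simp
    then have "?x \<in> Reg S f"
      by (rule RegI[OF S(1)[OF ab(1) S(1)[OF ab(2,1)]] ab(2)])
    moreover have "h ?x = t"
      using ab s S hm by simp
    ultimately show ?thesis
      by blast
  qed
  have "semigroup_on (Reg S f) f"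
    using closed S(2)[OF RegS RegS RegS] by (simp add: semigroup_on_def)
  moreover have "h ` Reg S f = Reg T g"
    using maps lifts by blast
  ultimately show ?thesis
    unfolding surj_semigroup_hom_def using RegT maps hm[OF RegS RegS] by simp
qed

section \<open>Regularity of matrices over a field\<close>

text \<open>Column \<open>i\<close> of \<open>R * G\<close> is the pivot column of row
  \<open>i\<close>, hence a unit vector, or zero if row \<open>i\<close> has no pivot. So
  \<open>R * G\<close> is a diagonal 0-1 matrix that keeps exactly the nonzero rows of
  \<open>R\<close>.\<close>

lemma row_echelon_form_regular:
  fixes R :: "'a::field mat"
  assumes R: "R \<in> carrier_mat nr nc" and ref: "row_echelon_form R"
  shows "\<exists>G \<in> carrier_mat nc nr. R * G * R = R"
proof -
  obtain p where p: "pivot_fun R p nc"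
    using ref R by (auto simp: row_echelon_form_def)
  have dim: "dim_row R = nr" "dim_col R = nc"
    using R by auto
  note piv = pivot_funD[OF dim(1) p]
  \<comment> \<open>A zero row has \<open>p i = nc\<close>, an index outside the range of
    \<open>k\<close>; its column in \<open>G\<close> is therefore zero.\<close>
  define G :: "'a mat" where "G = mat nc nr (\<lambda>(k, i). if k = p i then 1 else 0)"
  have G: "G \<in> carrier_mat nc nr"
    by (simp add: G_def)
  have RG: "(R * G) $$ (a, i) = (if a = i \<and> p i < nc then 1 else 0)"
    if "a < nr" "i < nr" for a i
  proof -
    have "(R * G) $$ (a, i) = (\<Sum>k = 0..<nc. R $$ (a, k) * (if k = p i then 1 else 0))"
      using that R G by (simp add: scalar_prod_def G_def)
    also have "\<dots> = (\<Sum>k = 0..<nc. if k = p i then R $$ (a, p i) else 0)"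
      by (rule sum.cong) auto
    also have "\<dots> = (if p i < nc then R $$ (a, p i) else 0)"
      by (simp add: sum.delta)
    finally show ?thesis
      using piv(4,5) that by auto
  qed
  have "R * G * R = R"
  proof (rule eq_matI)
    fix a j assume "a < dim_row R" "j < dim_col R"
    then have a: "a < nr" "j < nc"
      using R by auto
    have "(R * G * R) $$ (a, j) = (\<Sum>i = 0..<nr. (R * G) $$ (a, i) * R $$ (i, j))"
      using a R G by (simp add: scalar_prod_def del: assoc_mult_mat)
    also have "\<dots> = (\<Sum>i = 0..<nr. if i = a then (if p a < nc then R $$ (a, j) else 0) else 0)"
      using a by (intro sum.cong) (auto simp: RG simp del: index_mult_mat)
    also have "\<dots> = (if p a < nc then R $$ (a, j) else 0)"
      using a by (simp add: sum.delta)
    \<comment> \<open>If \<open>p a = nc\<close>, every entry of row \<open>a\<close> lies before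
      the pivot position and vanishes.\<close>
    also have "\<dots> = R $$ (a, j)"
      using piv(1,2) a by (metis le_neq_implies_less)
    finally show "(R * G * R) $$ (a, j) = R $$ (a, j)" .
  qed (use R G in auto)
  then show ?thesis
    using G by blast
qed

text \<open>Write \<open>R = P * A\<close> for the reduced form, with \<open>Q\<close> inverse to
  \<open>P\<close>. If \<open>R * G * R = R\<close>, then \<open>G * P\<close> works for
  \<open>A\<close>, because \<open>A * (G * P) * A = Q * (R * G * R) = Q * R = A\<close>.\<close>

lemma mat_regular:
  fixes A :: "'a::field mat"
  assumes A: "A \<in> carrier_mat nr nc"
  shows "\<exists>G \<in> carrier_mat nc nr. A * G * A = A"
proof -
  \<comment> \<open>The second argument is the block carried along in the elimination; here it has
    no columns.\<close>
  obtain R D where gj: "gauss_jordan A (0\<^sub>m nr 0) = (R, D)"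
    by fastforce
  from gauss_jordan_transform[OF A zero_carrier_mat gj, unfolded ring_mat_def Units_def, simplified]
  obtain P Q where P: "P \<in> carrier_mat nr nr" and Q: "Q \<in> carrier_mat nr nr"
    and QP: "Q * P = 1\<^sub>m nr" and RPA: "R = P * A"
    by auto
  have R: "R \<in> carrier_mat nr nc"
    using P A RPA by simp
  obtain G where G: "G \<in> carrier_mat nc nr" "R * G * R = R"
    using row_echelon_form_regular[OF R gauss_jordan_row_echelon[OF A gj]] by blast
  have QR: "Q * R = A"
    using assoc_mult_mat[OF Q P A] A by (simp add: QP RPA)
  have "A * (G * P) * A = Q * (R * G * R)"
  proof -
    have GR: "G * R \<in> carrier_mat nc nc"
      using G R by simp
    have "A * (G * P) * A = A * (G * R)"
      using assoc_mult_mat[OF A mult_carrier_mat[OF G(1) P] A] assoc_mult_mat[OF G(1) P A]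
      by (simp only: RPA)
    also have "\<dots> = Q * (R * G * R)"
      using assoc_mult_mat[OF Q R GR] assoc_mult_mat[OF R G(1) R] by (simp only: QR)
    finally show ?thesis .
  qed
  then have "A * (G * P) * A = A"
    using G QR by simp
  then show ?thesis
    using G P by (intro bexI[of _ "G * P"]) auto
qed

lemma semigroup_on_carrier_mat: "semigroup_on (carrier_mat k k) ((*) :: 'a::semiring_0 mat \<Rightarrow> _)"
  by (auto simp: semigroup_on_def)

text \<open>This is why the restricted maps \<open>Phi1\<close> and \<open>Phi2\<close> reach all of
  \<open>carrier_mat r r\<close>, and it starts the chain of closure results for regular
  elements.\<close>

lemma Reg_carrier_mat: "Reg (carrier_mat k k :: 'a::field mat set) (*) = carrier_mat k k"
proof -
  have "\<exists>G\<in>carrier_mat k k. A = A * G * A" if "A \<in> carrier_mat k k" for A :: "'a mat"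
    using mat_regular[OF that] by metis
  then show ?thesis
    unfolding Reg_def by blast
qed

section \<open>Entries of the sandwich matrix and of the four maps\<close>

lemma J_mat_carrier [simp]:
  assumes "r \<le> min m n"
  shows "J_mat m n r \<in> carrier_mat n m"
proof -
  have "J_mat m n r \<in> carrier_mat (r + (n - r)) (r + (m - r))"
    unfolding J_mat_def by (rule four_block_carrier_mat) auto
  then show ?thesis
    using assms by simp
qed

lemma index_J_mat:
  assumes "r \<le> min m n" "i < n" "j < m"
  shows "J_mat m n r $$ (i, j) = (if i = j \<and> i < r then 1 else 0)"
  using assms by (auto simp: J_mat_def)

lemma Psi1_carrier: "r \<le> min m n \<Longrightarrow> X \<in> carrier_mat m n \<Longrightarrow> Psi1 m n r X \<in> carrier_mat m m"
  unfolding Psi1_def by (meson J_mat_carrier mult_carrier_mat)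

lemma Psi2_carrier: "r \<le> min m n \<Longrightarrow> X \<in> carrier_mat m n \<Longrightarrow> Psi2 m n r X \<in> carrier_mat n n"
  unfolding Psi2_def by (meson J_mat_carrier mult_carrier_mat)

lemma index_Psi1:
  fixes X :: "'a::field mat"
  assumes r: "r \<le> min m n" and X: "X \<in> carrier_mat m n" and ij: "i < m" "j < m"
  shows "Psi1 m n r X $$ (i, j) = (if j < r then X $$ (i, j) else 0)"
proof -
  have J: "(J_mat m n r :: 'a mat) \<in> carrier_mat n m"
    using r by simp
  have "Psi1 m n r X $$ (i, j) = (\<Sum>k = 0..<n. X $$ (i, k) * J_mat m n r $$ (k, j))"
    using ij X carrier_matD[OF J] by (simp add: Psi1_def scalar_prod_def)
  \<comment> \<open>For \<open>j < r\<close>, column \<open>j\<close> of \<open>J_mat m n r\<close>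
    is a unit vector whose index \<open>j\<close> occurs in the sum because
    \<open>r \<le> n\<close>; the other columns are zero.\<close>
  also have "\<dots> = (\<Sum>k = 0..<n. if k = j then (if j < r then X $$ (i, j) else 0) else 0)"
    using r ij by (intro sum.cong) (auto simp: index_J_mat)
  finally show ?thesis
    using r by (auto simp: sum.delta)
qed

lemma index_Psi2:
  fixes X :: "'a::field mat"
  assumes r: "r \<le> min m n" and X: "X \<in> carrier_mat m n" and ij: "i < n" "j < n"
  shows "Psi2 m n r X $$ (i, j) = (if i < r then X $$ (i, j) else 0)"
proof -
  have J: "(J_mat m n r :: 'a mat) \<in> carrier_mat n m"
    using r by simp
  have "Psi2 m n r X $$ (i, j) = (\<Sum>k = 0..<m. J_mat m n r $$ (i, k) * X $$ (k, j))"
    using ij X carrier_matD[OF J] by (simp add: Psi2_def scalar_prod_def)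
  also have "\<dots> = (\<Sum>k = 0..<m. if k = i then (if i < r then X $$ (i, j) else 0) else 0)"
    using r ij by (intro sum.cong) (auto simp: index_J_mat)
  finally show ?thesis
    using r by (auto simp: sum.delta)
qed

lemma Phi1_eq_mat: "Phi1 r X = mat r r (($$) X)"
  by (auto simp: Phi1_def split_block_def Let_def)

lemma Phi2_eq_Phi1: "Phi2 = Phi1"
  by (simp add: fun_eq_iff Phi1_def Phi2_def)

lemma Phi1_index: "Phi1 r U = Phi1 r V \<Longrightarrow> i < r \<Longrightarrow> j < r \<Longrightarrow> U $$ (i, j) = V $$ (i, j)"
  by (metis Phi1_eq_mat index_mat(1))

section \<open>Products in \<open>C_mat\<close> and \<open>R_mat\<close>\<close>

text \<open>The vanishing hypothesis concerns products of entries, so it covers both a left factor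
  with zero columns and a right factor with zero rows.\<close>

lemma index_mult_truncated:
  fixes X Y :: "'a::semiring_0 mat"
  assumes X: "X \<in> carrier_mat a k" and Y: "Y \<in> carrier_mat k b" and r: "r \<le> k"
    and zero: "\<And>l. l < k \<Longrightarrow> r \<le> l \<Longrightarrow> X $$ (i, l) * Y $$ (l, j) = 0"
    and ij: "i < a" "j < b"
  shows "(X * Y) $$ (i, j) = (\<Sum>l<r. X $$ (i, l) * Y $$ (l, j))"
proof -
  have "(X * Y) $$ (i, j) = (\<Sum>l\<in>{..<k}. X $$ (i, l) * Y $$ (l, j))"
    using X Y ij by (simp add: scalar_prod_def atLeast0LessThan)
  also have "\<dots> = (\<Sum>l<r. X $$ (i, l) * Y $$ (l, j))"
    using zero r by (intro sum.mono_neutral_right) auto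
  finally show ?thesis .
qed

lemma index_mult_C_mat:
  assumes "r \<le> m" "X \<in> C_mat m r" "Y \<in> C_mat m r" "i < m" "j < m"
  shows "(X * Y) $$ (i, j) = (\<Sum>l<r. X $$ (i, l) * Y $$ (l, j))"
  using assms by (intro index_mult_truncated[of X m m Y m]) (auto simp: C_mat_def)

lemma index_mult_R_mat:
  assumes "r \<le> n" "X \<in> R_mat n r" "Y \<in> R_mat n r" "i < n" "j < n"
  shows "(X * Y) $$ (i, j) = (\<Sum>l<r. X $$ (i, l) * Y $$ (l, j))"
  using assms by (intro index_mult_truncated[of X n n Y n]) (auto simp: R_mat_def)

lemma C_mat_carrier: "X \<in> C_mat m r \<Longrightarrow> X \<in> carrier_mat m m"
  by (simp add: C_mat_def)

lemma R_mat_carrier: "X \<in> R_mat n r \<Longrightarrow> X \<in> carrier_mat n n"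
  by (simp add: R_mat_def)

lemma mult_C_mat:
  assumes "r \<le> m" "X \<in> C_mat m r" "Y \<in> C_mat m r"
  shows "X * Y \<in> C_mat m r"
proof -
  have "X * Y \<in> carrier_mat m m"
    using mult_carrier_mat[OF C_mat_carrier C_mat_carrier] assms by blast
  moreover have "(X * Y) $$ (i, j) = 0" if "i < m" "j < m" "r \<le> j" for i j
    using assms that by (subst index_mult_C_mat[of r]) (auto simp: C_mat_def intro!: sum.neutral)
  ultimately show ?thesis
    by (simp add: C_mat_def)
qed

lemma mult_R_mat:
  assumes "r \<le> n" "X \<in> R_mat n r" "Y \<in> R_mat n r"
  shows "X * Y \<in> R_mat n r"
proof -
  have "X * Y \<in> carrier_mat n n"
    using mult_carrier_mat[OF R_mat_carrier R_mat_carrier] assms by blast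
  moreover have "(X * Y) $$ (i, j) = 0" if "i < n" "j < n" "r \<le> i" for i j
    using assms that by (subst index_mult_R_mat[of r]) (auto simp: R_mat_def intro!: sum.neutral)
  ultimately show ?thesis
    by (simp add: R_mat_def)
qed

lemma semigroup_on_C_mat: "r \<le> m \<Longrightarrow> semigroup_on (C_mat m r) (*)"
  by (auto simp: semigroup_on_def intro: mult_C_mat
      assoc_mult_mat[OF C_mat_carrier C_mat_carrier C_mat_carrier])

lemma semigroup_on_R_mat: "r \<le> n \<Longrightarrow> semigroup_on (R_mat n r) (*)"
  by (auto simp: semigroup_on_def intro: mult_R_mat
      assoc_mult_mat[OF R_mat_carrier R_mat_carrier R_mat_carrier])

section \<open>The sandwich semigroup and its two projections\<close>

lemma star_mat_eq_Psi1: "star_mat m n r X Y = Psi1 m n r X * Y"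
  by (simp add: star_mat_def Psi1_def)

lemma star_mat_eq_Psi2:
  assumes "r \<le> min m n" "X \<in> carrier_mat m n" "Y \<in> carrier_mat m n"
  shows "star_mat m n r X Y = X * Psi2 m n r Y"
  unfolding star_mat_def Psi2_def
  by (rule assoc_mult_mat[OF assms(2) J_mat_carrier[OF assms(1)] assms(3)])

lemma star_mat_carrier:
  assumes "r \<le> min m n" "X \<in> carrier_mat m n" "Y \<in> carrier_mat m n"
  shows "star_mat m n r X Y \<in> carrier_mat m n"
  unfolding star_mat_def
  by (rule mult_carrier_mat[OF mult_carrier_mat[OF assms(2) J_mat_carrier[OF assms(1)]] assms(3)])

lemma Psi1_star_mat:
  assumes "r \<le> min m n" "X \<in> carrier_mat m n" "Y \<in> carrier_mat m n"
  shows "Psi1 m n r (star_mat m n r X Y) = Psi1 m n r X * Psi1 m n r Y"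
  unfolding star_mat_eq_Psi1 Psi1_def[of m n r "_ * _"] Psi1_def[of m n r Y]
  by (rule assoc_mult_mat[OF Psi1_carrier[OF assms(1,2)] assms(3) J_mat_carrier[OF assms(1)]])

lemma Psi2_star_mat:
  assumes "r \<le> min m n" "X \<in> carrier_mat m n" "Y \<in> carrier_mat m n"
  shows "Psi2 m n r (star_mat m n r X Y) = Psi2 m n r X * Psi2 m n r Y"
  unfolding star_mat_eq_Psi2[OF assms] Psi2_def[of m n r "_ * _"] Psi2_def[of m n r X]
  by (rule assoc_mult_mat[OF J_mat_carrier[OF assms(1)] assms(2) Psi2_carrier[OF assms(1,3)],
        symmetric])

text \<open>A left factor acts through its image under \<open>Psi1\<close>, so associativity follows
  from multiplicativity of \<open>Psi1\<close> and associativity of the matrix product.\<close>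

lemma semigroup_on_star_mat:
  assumes "r \<le> min m n"
  shows "semigroup_on (carrier_mat m n) (star_mat m n r)"
proof -
  have "star_mat m n r (star_mat m n r X Y) Z = star_mat m n r X (star_mat m n r Y Z)"
    if "X \<in> carrier_mat m n" "Y \<in> carrier_mat m n" "Z \<in> carrier_mat m n" for X Y Z :: "'a mat"
  proof -
    have "star_mat m n r (star_mat m n r X Y) Z = Psi1 m n r X * Psi1 m n r Y * Z"
      using that assms by (simp add: star_mat_eq_Psi1[of m n r "star_mat m n r X Y"] Psi1_star_mat)
    also have "\<dots> = Psi1 m n r X * (Psi1 m n r Y * Z)"
      using that assms by (meson Psi1_carrier assoc_mult_mat)
    finally show ?thesis
      by (simp add: star_mat_eq_Psi1)
  qed
  then show ?thesis
    using assms by (simp add: semigroup_on_def star_mat_carrier)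
qed

lemma surj_semigroup_hom_Psi1:
  assumes r: "r \<le> min m n"
  shows "surj_semigroup_hom (carrier_mat m n :: 'a::field mat set) (star_mat m n r)
    (C_mat m r) (*) (Psi1 m n r)"
proof -
  have into: "Psi1 m n r X \<in> C_mat m r" if "X \<in> carrier_mat m n" for X :: "'a mat"
    using that r by (simp add: C_mat_def Psi1_carrier index_Psi1)
  have onto: "\<exists>X \<in> carrier_mat m n. Psi1 m n r X = Y" if Y: "Y \<in> C_mat m r" for Y :: "'a mat"
  proof -
    \<comment> \<open>The first \<open>r\<close> columns of \<open>Y\<close> are kept and padded
      with zeros to width \<open>n\<close>; the remaining columns of \<open>Y\<close> are zero
      anyway.\<close>
    let ?X = "mat m n (\<lambda>(i, j). if j < r then Y $$ (i, j) else 0)"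
    have X: "?X \<in> carrier_mat m n"
      by simp
    have "Psi1 m n r ?X = Y"
    proof (rule eq_matI)
      fix i j assume "i < dim_row Y" "j < dim_col Y"
      then show "Psi1 m n r ?X $$ (i, j) = Y $$ (i, j)"
        using Y r by (auto simp: index_Psi1[OF r X] C_mat_def)
    qed (use Y Psi1_carrier[OF r X] in \<open>auto simp: C_mat_def\<close>)
    then show ?thesis
      using X by blast
  qed
  show ?thesis
    unfolding surj_semigroup_hom_def
    using r into onto by (auto simp: semigroup_on_star_mat semigroup_on_C_mat Psi1_star_mat
      image_iff)
qed

lemma surj_semigroup_hom_Psi2:
  assumes r: "r \<le> min m n"
  shows "surj_semigroup_hom (carrier_mat m n :: 'a::field mat set) (star_mat m n r)
    (R_mat n r) (*) (Psi2 m n r)"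
proof -
  have into: "Psi2 m n r X \<in> R_mat n r" if "X \<in> carrier_mat m n" for X :: "'a mat"
    using that r by (simp add: R_mat_def Psi2_carrier index_Psi2)
  have onto: "\<exists>X \<in> carrier_mat m n. Psi2 m n r X = Y" if Y: "Y \<in> R_mat n r" for Y :: "'a mat"
  proof -
    let ?X = "mat m n (\<lambda>(i, j). if i < r then Y $$ (i, j) else 0)"
    have X: "?X \<in> carrier_mat m n"
      by simp
    have "Psi2 m n r ?X = Y"
    proof (rule eq_matI)
      fix i j assume "i < dim_row Y" "j < dim_col Y"
      then show "Psi2 m n r ?X $$ (i, j) = Y $$ (i, j)"
        using Y r by (auto simp: index_Psi2[OF r X] R_mat_def)
    qed (use Y Psi2_carrier[OF r X] in \<open>auto simp: R_mat_def\<close>)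
    then show ?thesis
      using X by blast
  qed
  show ?thesis
    unfolding surj_semigroup_hom_def
    using r into onto by (auto simp: semigroup_on_star_mat semigroup_on_R_mat Psi2_star_mat
      image_iff)
qed

section \<open>Passing to the upper left block\<close>

text \<open>Multiplicativity on upper left blocks amounts to the truncated product formula. With
  that formula as hypothesis, the lemma serves \<open>C_mat\<close> and \<open>R_mat\<close>
  alike.\<close>

lemma Phi1_mult:
  fixes X Y :: "'a::field mat"
  assumes "\<And>i j. i < r \<Longrightarrow> j < r \<Longrightarrow> (X * Y) $$ (i, j) = (\<Sum>l<r. X $$ (i, l) * Y $$ (l, j))"
  shows "Phi1 r (X * Y) = Phi1 r X * Phi1 r Y"
proof (rule eq_matI)
  fix i j assume "i < dim_row (Phi1 r X * Phi1 r Y)" "j < dim_col (Phi1 r X * Phi1 r Y)"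
  then have "i < r" "j < r"
    by (auto simp: Phi1_eq_mat)
  then show "Phi1 r (X * Y) $$ (i, j) = (Phi1 r X * Phi1 r Y) $$ (i, j)"
    using assms by (simp add: Phi1_eq_mat scalar_prod_def atLeast0LessThan del: index_mult_mat(1))
      (simp add: scalar_prod_def atLeast0LessThan)
qed (auto simp: Phi1_eq_mat)

text \<open>Padding \<open>A\<close> by zeros on both sides lands in the intersection, so one
  preimage serves both surjectivity claims.\<close>

lemma Phi1_onto:
  assumes "r \<le> k" "A \<in> carrier_mat r r"
  shows "\<exists>X \<in> C_mat k r \<inter> R_mat k r. Phi1 r X = A"
proof
  let ?X = "mat k k (\<lambda>(i, j). if i < r \<and> j < r then A $$ (i, j) else 0)"
  show "?X \<in> C_mat k r \<inter> R_mat k r"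
    by (simp add: C_mat_def R_mat_def)
  show "Phi1 r ?X = A"
    using assms by (intro eq_matI) (auto simp: Phi1_eq_mat)
qed

lemma Phi1_carrier: "Phi1 r X \<in> carrier_mat r r"
  by (simp add: Phi1_eq_mat)

lemma surj_semigroup_hom_Phi1:
  assumes "r \<le> m"
  shows "surj_semigroup_hom (C_mat m r :: 'a::field mat set) (*) (carrier_mat r r) (*) (Phi1 r)"
proof -
  have "Phi1 r (X * Y) = Phi1 r X * Phi1 r Y"
    if "X \<in> C_mat m r" "Y \<in> C_mat m r" for X Y :: "'a mat"
    using that assms by (intro Phi1_mult index_mult_C_mat[of r m]) auto
  moreover have "Phi1 r ` (C_mat m r :: 'a mat set) = carrier_mat r r"
    using Phi1_onto[OF assms] Phi1_carrier by (auto simp: image_iff)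
  ultimately show ?thesis
    unfolding surj_semigroup_hom_def
    using assms by (auto simp: semigroup_on_carrier_mat semigroup_on_C_mat Phi1_carrier)
qed

lemma surj_semigroup_hom_Phi2:
  assumes "r \<le> n"
  shows "surj_semigroup_hom (R_mat n r :: 'a::field mat set) (*) (carrier_mat r r) (*) (Phi2 r)"
proof -
  have "Phi1 r (X * Y) = Phi1 r X * Phi1 r Y"
    if "X \<in> R_mat n r" "Y \<in> R_mat n r" for X Y :: "'a mat"
    using that assms by (intro Phi1_mult index_mult_R_mat[of r n]) auto
  moreover have "Phi1 r ` (R_mat n r :: 'a mat set) = carrier_mat r r"
    using Phi1_onto[OF assms] Phi1_carrier by (auto simp: image_iff)
  ultimately show ?thesis
    unfolding surj_semigroup_hom_def Phi2_eq_Phi1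
    using assms by (auto simp: semigroup_on_carrier_mat semigroup_on_R_mat Phi1_carrier)
qed

section \<open>Restriction to regular elements\<close>

text \<open>The zero columns of \<open>X\<close> hide all rows of \<open>U\<close> from index
  \<open>r\<close> on. The visible rows consist of the block \<open>Phi1 r U\<close> followed by
  zeros.\<close>

lemma Phi1_sandwich:
  fixes X U V :: "'a::field mat"
  assumes r: "r \<le> m" and X: "X \<in> C_mat m r" and U: "U \<in> C_mat m r" and V: "V \<in> C_mat m r"
    and eq: "Phi1 r U = Phi1 r V"
  shows "X * U = X * V"
proof (rule eq_matI)
  fix i j assume "i < dim_row (X * V)" "j < dim_col (X * V)"
  then have ij: "i < m" "j < m"
    using C_mat_carrier[OF X] C_mat_carrier[OF V] by auto
  have "U $$ (l, j) = V $$ (l, j)" if "l < r" for l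
    using that ij r U V Phi1_index[OF eq that, of j] by (cases "j < r") (auto simp: C_mat_def)
  then show "(X * U) $$ (i, j) = (X * V) $$ (i, j)"
    using index_mult_C_mat[OF r X U ij] index_mult_C_mat[OF r X V ij] by simp
qed (use C_mat_carrier[OF U] C_mat_carrier[OF V] in auto)

text \<open>Here the right factor does the hiding: the zero rows of \<open>Y\<close> leave only the
  first \<open>r\<close> columns of \<open>U\<close> visible, and these are \<open>Phi2 r U\<close>
  above zeros.\<close>

lemma Phi2_sandwich:
  fixes Y U V :: "'a::field mat"
  assumes r: "r \<le> n" and Y: "Y \<in> R_mat n r" and U: "U \<in> R_mat n r" and V: "V \<in> R_mat n r"
    and eq: "Phi2 r U = Phi2 r V"
  shows "U * Y = V * Y"
proof (rule eq_matI)
  fix i j assume "i < dim_row (V * Y)" "j < dim_col (V * Y)"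
  then have ij: "i < n" "j < n"
    using R_mat_carrier[OF Y] R_mat_carrier[OF V] by auto
  have "U $$ (i, l) = V $$ (i, l)" if "l < r" for l
    using that ij r U V Phi1_index[OF eq[unfolded Phi2_eq_Phi1] _ that, of i]
    by (cases "i < r") (auto simp: R_mat_def)
  then show "(U * Y) $$ (i, j) = (V * Y) $$ (i, j)"
    using index_mult_R_mat[OF r U Y ij] index_mult_R_mat[OF r V Y ij] by simp
qed (use R_mat_carrier[OF U] R_mat_carrier[OF V] in auto)

lemma surj_semigroup_hom_Phi1_Reg:
  assumes "r \<le> m"
  shows "surj_semigroup_hom (Reg (C_mat m r :: 'a::field mat set) (*)) (*)
    (carrier_mat r r) (*) (Phi1 r)"
proof -
  have "surj_semigroup_hom (Reg (C_mat m r :: 'a mat set) (*)) (*)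
      (Reg (carrier_mat r r) (*)) (*) (Phi1 r)"
  proof (rule surj_semigroup_hom_Reg[OF surj_semigroup_hom_Phi1[OF assms]])
    fix X Y U V :: "'a mat"
    assume *: "X \<in> C_mat m r" "Y \<in> C_mat m r" "U \<in> C_mat m r" "V \<in> C_mat m r"
      and eq: "Phi1 r U = Phi1 r V"
    \<comment> \<open>Rebracketing to \<open>(X * U) * Y\<close> exposes the left multiplication by
      \<open>X\<close>.\<close>
    show "X * (U * Y) = X * (V * Y)"
      using Phi1_sandwich[OF assms *(1,3,4) eq] semigroup_onD(2)[OF semigroup_on_C_mat[OF assms]] *
      by metis
  qed (simp add: Reg_carrier_mat semigroup_on_carrier_mat)
  then show ?thesis
    by (simp add: Reg_carrier_mat)
qed

lemma surj_semigroup_hom_Phi2_Reg: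
  assumes "r \<le> n"
  shows "surj_semigroup_hom (Reg (R_mat n r :: 'a::field mat set) (*)) (*)
    (carrier_mat r r) (*) (Phi2 r)"
proof -
  have "surj_semigroup_hom (Reg (R_mat n r :: 'a mat set) (*)) (*)
      (Reg (carrier_mat r r) (*)) (*) (Phi2 r)"
  proof (rule surj_semigroup_hom_Reg[OF surj_semigroup_hom_Phi2[OF assms]])
    fix X Y U V :: "'a mat"
    assume "Y \<in> R_mat n r" "U \<in> R_mat n r" "V \<in> R_mat n r" "Phi2 r U = Phi2 r V"
    then show "X * (U * Y) = X * (V * Y)"
      using Phi2_sandwich[OF assms] by metis
  qed (simp add: Reg_carrier_mat semigroup_on_carrier_mat)
  then show ?thesis
    by (simp add: Reg_carrier_mat)
qed

text \<open>Both composites send \<open>X\<close> to its own upper left block of size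
  \<open>r\<close>.\<close>

lemma Phi1_Psi1_eq_Phi2_Psi2:
  assumes "r \<le> min m n" "X \<in> carrier_mat m n"
  shows "Phi1 r (Psi1 m n r X) = Phi2 r (Psi2 m n r X)"
  using assms by (intro eq_matI) (auto simp: Phi2_eq_Phi1 Phi1_eq_mat index_Psi1 index_Psi2)

lemma surj_semigroup_hom_Psi1_Reg:
  assumes r: "r \<le> min m n"
  shows "surj_semigroup_hom (Reg (carrier_mat m n :: 'a::field mat set) (star_mat m n r))
    (star_mat m n r) (Reg (C_mat m r) (*)) (*) (Psi1 m n r)"
proof (rule surj_semigroup_hom_Reg[OF surj_semigroup_hom_Psi1[OF r]])
  \<comment> \<open>Closure climbs in two stages: from \<open>carrier_mat r r\<close> to
    \<open>C_mat m r\<close> along \<open>Phi1\<close>, and from there to the sandwich semigroup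
    along \<open>Psi1\<close>.\<close>
  show "semigroup_on (Reg (C_mat m r :: 'a mat set) (*)) (*)"
    by (rule surj_semigroup_hom_Phi1_Reg[unfolded surj_semigroup_hom_def, THEN conjunct1])
      (use r in simp)
qed (simp add: star_mat_eq_Psi1)

lemma surj_semigroup_hom_Psi2_Reg:
  assumes r: "r \<le> min m n"
  shows "surj_semigroup_hom (Reg (carrier_mat m n :: 'a::field mat set) (star_mat m n r))
    (star_mat m n r) (Reg (R_mat n r) (*)) (*) (Psi2 m n r)"
proof (rule surj_semigroup_hom_Reg[OF surj_semigroup_hom_Psi2[OF r]])
  show "semigroup_on (Reg (R_mat n r :: 'a mat set) (*)) (*)"
    by (rule surj_semigroup_hom_Phi2_Reg[unfolded surj_semigroup_hom_def, THEN conjunct1])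
      (use r in simp)
  fix X Y U V :: "'a mat"
  assume "X \<in> carrier_mat m n" "Y \<in> carrier_mat m n" "U \<in> carrier_mat m n" "V \<in> carrier_mat m n"
    and "Psi2 m n r U = Psi2 m n r V"
  \<comment> \<open>Both sides take the form \<open>X * (Psi2 m n r U * Psi2 m n r Y)\<close>, with
    \<open>V\<close> for \<open>U\<close> on the right.\<close>
  then show "star_mat m n r X (star_mat m n r U Y) = star_mat m n r X (star_mat m n r V Y)"
    using r by (simp add: star_mat_eq_Psi2[of r m n X] star_mat_carrier Psi2_star_mat)
qed


theorem theorem5p7:
  fixes m n r :: nat
  assumes "m \<ge> 1" and "n \<ge> 1" and "r \<le> min m n"
  shows
    "surj_semigroup_hom (carrier_mat m n :: 'a::field mat set) (star_mat m n r)
       (C_mat m r) (*) (Psi1 m n r) \<and>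
     surj_semigroup_hom (carrier_mat m n :: 'a mat set) (star_mat m n r)
       (R_mat n r) (*) (Psi2 m n r) \<and>
     surj_semigroup_hom (C_mat m r :: 'a mat set) (*) (carrier_mat r r) (*) (Phi1 r) \<and>
     surj_semigroup_hom (R_mat n r :: 'a mat set) (*) (carrier_mat r r) (*) (Phi2 r) \<and>
     (\<forall>X \<in> (carrier_mat m n :: 'a mat set).
        (Phi1 r \<circ> Psi1 m n r) X = (Phi2 r \<circ> Psi2 m n r) X) \<and>
     surj_semigroup_hom (Reg (carrier_mat m n :: 'a mat set) (star_mat m n r)) (star_mat m n r)
       (Reg (C_mat m r) (*)) (*) (Psi1 m n r) \<and>
     surj_semigroup_hom (Reg (carrier_mat m n :: 'a mat set) (star_mat m n r)) (star_mat m n r)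
       (Reg (R_mat n r) (*)) (*) (Psi2 m n r) \<and>
     surj_semigroup_hom (Reg (C_mat m r :: 'a mat set) (*)) (*) (carrier_mat r r) (*) (Phi1 r) \<and>
     surj_semigroup_hom (Reg (R_mat n r :: 'a mat set) (*)) (*) (carrier_mat r r) (*) (Phi2 r) \<and>
     (\<forall>X \<in> Reg (carrier_mat m n :: 'a mat set) (star_mat m n r).
        (Phi1 r \<circ> Psi1 m n r) X = (Phi2 r \<circ> Psi2 m n r) X)"
proof (intro conjI ballI)
  fix X :: "'a mat" assume "X \<in> Reg (carrier_mat m n) (star_mat m n r)"
  then show "(Phi1 r \<circ> Psi1 m n r) X = (Phi2 r \<circ> Psi2 m n r) X"
    using assms by (simp add: Reg_def Phi1_Psi1_eq_Phi2_Psi2)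
qed (use assms in \<open>simp_all add: surj_semigroup_hom_Psi1 surj_semigroup_hom_Psi2
    surj_semigroup_hom_Phi1 surj_semigroup_hom_Phi2 Phi1_Psi1_eq_Phi2_Psi2
    surj_semigroup_hom_Psi1_Reg surj_semigroup_hom_Psi2_Reg
    surj_semigroup_hom_Phi1_Reg surj_semigroup_hom_Phi2_Reg\<close>)

end
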